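(* Let $\mathbf c_0^*=(Q_{e,\epsilon}(l_e/2))_{e\in\mathcal E}$, $\mathbf R^*=\operatorname{diag}\big((1/Q_{e,\epsilon}'(l_e/2))_{e\in\mathcal E}\big)$ and $\mathbf L^*=\mathbf I(\mathbf R^* )^{-1}\mathbf I^{\mathrm T}$. Then $$\tilde{\mathbf c}=\mathbf c_0^*-(\mathbf R^* )^{-1}\mathbf I^{\mathrm T}(\mathbf L^* )^\dagger(\mathbf I\mathbf c_0^*-\mathbf I^+\mathbf s)$$ is the unique solution of the quadratic minimum-energy flow problem $$\min_{\mathbf c\in\mathbb R^{|\mathcal E|}}\ \tfrac12(\mathbf c-\mathbf c_0^* )^{\mathrm T}\mathbf R^*(\mathbf c-\mathbf c_0^* )\quad\text{s.t.}\quad\mathbf I\mathbf c=\mathbf I^+\mathbf s,$$ whose minimum objective value is $$\tfrac12(\mathbf I\mathbf c_0^*-\mathbf I^+\mathbf s)^{\mathrm T}(\mathbf L^* )^\dagger(\mathbf I\mathbf c_0^*-\mathbf I^+\mathbf s),$$ where $\dagger$ denotes the Moore–Penrose inverse.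
   Context: $(\mathcal V,\mathcal E)$ is an undirected network. Each edge $e\in\mathcal E$ has length $l_e\ge 0$ and end nodes $v_e^-,v_e^+\in\mathcal V$ (an arbitrary orientation from $v_e^-$ to $v_e^+$ is fixed). A location on $e$ is recorded as $(e,x)$, $x\in[0,l_e]$, where $x$ is the distance from $v_e^-$ along $e$. Put $\mathcal L_e(x)=\{(e,y):y\in[0,x]\}$ and $\mathcal L=\bigcup_{e}\mathcal L_e(l_e)$. $U,V\subset\mathcal L$ are finite sets of supply and demand points with $|U|=|V|=n$, matched along shortest paths in the network (so the flow conservation constraint $\mathbf I\mathbf c=\mathbf I^+\mathbf s$ below is feasible). The imbalance profile of edge $e$ is $S_e(x)=|U\cap\mathcal L_e(x)|-|V\cap\mathcal L_e(x)|$ for $x\in[0,l_e]$, and $\mathbf s=(S_e(l_e))_{e\in\mathcal E}$. For a profile $\xi_e:[0,l_e]\to\mathbb R$: $F_e(c;\xi_e)$ is the Lebesgue measure of $\{x\in[0,l_e]:\xi_e(x)\le c\}$ and $Q_e(t;\xi_e)=\inf\{c:F_e(c;\xi_e)\ge t\}$. $\mathbf I^+$ (resp. $\mathbf I^-$) is the $\mathcal V\times\mathcal E$ matrix whose $(v,e)$ entry is $1$ if $v_e^+=v$ (resp. $v_e^-=v$) and $0$ otherwise; $\mathbf I=\mathbf I^+-\mathbf I^-$. For a smoothing parameter $\epsilon>0$, $Q_{e,\epsilon}$ is an approximation of $Q_e(\cdot;S_e)$ with $Q_{e,\epsilon}\in C^2([0,l_e])$, $Q_{e,\epsilon}'>0$,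 and $\max_e\|Q_{e,\epsilon}-Q_e(\cdot;S_e)\|_{L^1(0,l_e)}\to0$ as $\epsilon\downarrow0$. *)

theory Defs
  imports "HOL-Analysis.Analysis"
begin

text \<open>
  A network is given by finite types of nodes and edges, the tail \<open>vm e\<close> and head \<open>vp e\<close> of every
  edge, and the edge lengths \<open>l e\<close>.  Self-loops and parallel edges are allowed.
\<close>

type_synonym 'e location = "'e \<times> real"

definition edge_upto :: "'e \<Rightarrow> real \<Rightarrow> 'e location set" where
  "edge_upto e x = {(e, y) | y. 0 \<le> y \<and> y \<le> x}"

definition locations :: "('e \<Rightarrow> real) \<Rightarrow> 'e location set" where
  "locations l = (\<Union>e. edge_upto e (l e))"

text \<open>Edges may be traversed in both directions.\<close>

fun walk :: "('e \<Rightarrow> 'v) \<Rightarrow> ('e \<Rightarrow> 'v) \<Rightarrow> 'v \<Rightarrow> 'e list \<Rightarrow> 'v \<Rightarrow> bool" where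
  "walk vm vp a [] b \<longleftrightarrow> a = b"
| "walk vm vp a (e # es) b \<longleftrightarrow>
     (vm e = a \<and> walk vm vp (vp e) es b) \<or> (vp e = a \<and> walk vm vp (vm e) es b)"

inductive end_distance ::
  "('e \<Rightarrow> real) \<Rightarrow> ('e \<Rightarrow> 'v) \<Rightarrow> ('e \<Rightarrow> 'v) \<Rightarrow> 'e location \<Rightarrow> 'v \<Rightarrow> real \<Rightarrow> bool"
  for l vm vp where
  to_tail: "end_distance l vm vp (e, x) (vm e) x"
| to_head: "end_distance l vm vp (e, x) (vp e) (l e - x)"

text \<open>
  \<open>route l vm vp p q d\<close>: some path of length \<open>d\<close> joins the locations \<open>p\<close> and \<open>q\<close>, either
  inside a common edge or leaving the edge of \<open>p\<close> and entering that of \<open>q\<close> at end nodes.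
\<close>

inductive route ::
  "('e \<Rightarrow> real) \<Rightarrow> ('e \<Rightarrow> 'v) \<Rightarrow> ('e \<Rightarrow> 'v) \<Rightarrow> 'e location \<Rightarrow> 'e location \<Rightarrow> real \<Rightarrow> bool"
  for l vm vp where
  within_edge: "route l vm vp (e, x) (e, y) \<bar>x - y\<bar>"
| via_nodes: "end_distance l vm vp p a d1 \<Longrightarrow> walk vm vp a es b \<Longrightarrow> end_distance l vm vp q b d2 \<Longrightarrow>
    route l vm vp p q (d1 + sum_list (map l es) + d2)"

definition shortest_route ::
  "('e \<Rightarrow> real) \<Rightarrow> ('e \<Rightarrow> 'v) \<Rightarrow> ('e \<Rightarrow> 'v) \<Rightarrow> 'e location \<Rightarrow> 'e location \<Rightarrow> real \<Rightarrow> bool" where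
  "shortest_route l vm vp p q d \<longleftrightarrow>
     route l vm vp p q d \<and> (\<forall>d'. route l vm vp p q d' \<longrightarrow> d \<le> d')"

definition imbalance :: "'e location set \<Rightarrow> 'e location set \<Rightarrow> 'e \<Rightarrow> real \<Rightarrow> real" where
  "imbalance U V e x = real (card (U \<inter> edge_upto e x)) - real (card (V \<inter> edge_upto e x))"

definition profile_cdf :: "real \<Rightarrow> (real \<Rightarrow> real) \<Rightarrow> real \<Rightarrow> real" where
  "profile_cdf len \<xi> c = measure lebesgue {x \<in> {0..len}. \<xi> x \<le> c}"

text \<open>
  At \<open>t = 0\<close> the infimum is over all reals (mathematically minus infinity), so
  \<open>profile_quantile len \<xi> 0\<close> is an unspecified real.  Below the quantile function is used only
  inside an integral over \<open>t\<close>, where this single point is irrelevant.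
\<close>

definition profile_quantile :: "real \<Rightarrow> (real \<Rightarrow> real) \<Rightarrow> real \<Rightarrow> real" where
  "profile_quantile len \<xi> t = Inf {c. profile_cdf len \<xi> c \<ge> t}"

definition L1_dist :: "real \<Rightarrow> (real \<Rightarrow> real) \<Rightarrow> (real \<Rightarrow> real) \<Rightarrow> real" where
  "L1_dist len f g = (LINT t:{0<..<len}|lebesgue. \<bar>f t - g t\<bar>)"

text \<open>
  Twice continuously differentiable on \<open>{a..b}\<close> with first derivative \<open>f'\<close> (one-sided derivatives
  at the end points).  The derivative is a parameter because for \<open>a = b\<close> it is not determined by
  \<open>f\<close>; for \<open>a < b\<close> it is.
\<close>

definition C2_with_deriv :: "real \<Rightarrow> real \<Rightarrow> (real \<Rightarrow> real) \<Rightarrow> (real \<Rightarrow> real) \<Rightarrow> bool" where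
  "C2_with_deriv a b f f' \<longleftrightarrow>
     (\<forall>x\<in>{a..b}. (f has_real_derivative f' x) (at x within {a..b})) \<and>
     (\<exists>f''. (\<forall>x\<in>{a..b}. (f' has_real_derivative f'' x) (at x within {a..b})) \<and>
            continuous_on {a..b} f'')"

definition head_matrix :: "('e::finite \<Rightarrow> 'v::finite) \<Rightarrow> real ^ 'e ^ 'v" where
  "head_matrix vp = (\<chi> v e. if vp e = v then 1 else 0)"

definition tail_matrix :: "('e::finite \<Rightarrow> 'v::finite) \<Rightarrow> real ^ 'e ^ 'v" where
  "tail_matrix vm = (\<chi> v e. if vm e = v then 1 else 0)"

definition incidence_matrix ::
  "('e::finite \<Rightarrow> 'v::finite) \<Rightarrow> ('e \<Rightarrow> 'v) \<Rightarrow> real ^ 'e ^ 'v" where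
  "incidence_matrix vm vp = head_matrix vp - tail_matrix vm"

definition diag_matrix :: "('e::finite \<Rightarrow> real) \<Rightarrow> real ^ 'e ^ 'e" where
  "diag_matrix d = (\<chi> i j. if i = j then d i else 0)"

definition is_moore_penrose :: "real ^ 'n ^ 'm \<Rightarrow> real ^ 'm ^ 'n \<Rightarrow> bool" where
  "is_moore_penrose A X \<longleftrightarrow>
     A ** X ** A = A \<and> X ** A ** X = X \<and>
     transpose (A ** X) = A ** X \<and> transpose (X ** A) = X ** A"

definition moore_penrose :: "real ^ 'n ^ 'm \<Rightarrow> real ^ 'm ^ 'n" where
  "moore_penrose A = (THE X. is_moore_penrose A X)"

end

theory Submission
  imports Defs
begin

text \<open>
  Feasibility of the constraint: modulo the column space of \<open>I\<close>, all nodes of one connected component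
  have the same unit vector, and \<open>I\<^sup>+ s\<close> is the sum over \<open>u \<in> U\<close> of the unit vector of the
  head of the edge of \<open>u\<close> minus that of the edge of its partner.  For the minimisation,
  \<open>L\<close> has the same column space as \<open>I\<close>, so the multiplier \<open>p = (L)\<^sup>\<dagger> r\<close> solves
  \<open>L p = r\<close>; then \<open>R (c\<^sub>0 - c') = I\<^sup>T p\<close> is orthogonal to every feasible direction, and the
  objective at a feasible \<open>c\<close> exceeds that at \<open>c'\<close> by half the energy of \<open>c - c'\<close>.
\<close>

section \<open>Column spaces and least squares\<close>

lemma inner_matrix_vector_mult:
  fixes A :: "real^'n^'m"
  shows "x \<bullet> (A *v y) = (transpose A *v x) \<bullet> y"
  by (simp add: dot_lmul_matrix)

lemma subspace_range_matrix:
  fixes A :: "real^'n^'m"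
  shows "subspace (range ((*v) A))"
  by (intro linear_subspace_image) auto

text \<open>The orthogonal projection of \<open>y\<close> onto the column space is some
  \<open>A *v x\<close>; the remainder is orthogonal to every \<open>A *v w\<close>, which says
  exactly that \<open>transpose A\<close> kills it.\<close>

lemma normal_equations_solvable:
  fixes A :: "real^'n^'m"
  obtains x where "transpose A *v (y - A *v x) = 0"
proof -
  obtain a z where "a \<in> span (range ((*v) A))"
    and orth: "\<And>w. w \<in> span (range ((*v) A)) \<Longrightarrow> orthogonal z w" and y: "y = a + z"
    using orthogonal_subspace_decomp_exists[of "range ((*v) A)" y] by blast
  then obtain x where a: "a = A *v x"
    using subspace_range_matrix by (metis imageE span_eq_iff)
  have "(transpose A *v z) \<bullet> w = 0" for w
    using orth[OF span_base, of "A *v w"]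
    by (simp only: inner_matrix_vector_mult[symmetric] orthogonal_def rangeI)
  then have "transpose A *v z = 0"
    by (metis inner_eq_zero_iff)
  then show thesis
    using that[of x] y a by (simp only: add_diff_cancel_left')
qed

section \<open>The Moore--Penrose inverse\<close>

text \<open>The columns of \<open>Y\<close> are least-squares solutions for the unit vectors, so
  \<open>A ** Y\<close> is the orthogonal projector onto the column space of
  \<open>A\<close>.\<close>

lemma exists_least_squares_inverse:
  fixes A :: "real^'n^'m"
  obtains Y where "A ** Y ** A = A" "transpose (A ** Y) = A ** Y"
proof -
  have "\<exists>x. transpose A *v (axis j 1 - A *v x) = 0" for j
    using normal_equations_solvable[of A "axis j 1"] by blast
  then obtain x where x: "\<And>j. transpose A *v (axis j 1 - A *v x j) = 0"
    by metis
  define Y where "Y = (\<chi> i j. x j $ i)"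
  have col: "Y *v axis j 1 = x j" for j
    by (simp add: matrix_vector_mult_basis column_def Y_def vec_eq_iff)
  have "column j (transpose A ** (A ** Y)) = column j (transpose A)" for j
    using x[of j]
    by (simp only: matrix_vector_mult_basis[symmetric] matrix_vector_mul_assoc[symmetric] col
        matrix_vector_mult_diff_distrib right_minus_eq)
  then have Y: "transpose A ** (A ** Y) = transpose A"
    by (simp add: vec_eq_iff column_def)
  \<comment> \<open>Substituting the normal equations turns the transpose of \<open>A ** Y\<close>
    into the Gram matrix of the columns of \<open>A ** Y\<close>, which is symmetric.\<close>
  have sym: "transpose (A ** Y) = A ** Y"
  proof -
    have "transpose (A ** Y) = transpose Y ** (transpose A ** (A ** Y))"
      by (simp only: matrix_transpose_mul Y)
    also have "\<dots> = transpose (transpose Y ** (transpose A ** (A ** Y)))"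
      by (simp only: matrix_transpose_mul transpose_transpose matrix_mul_assoc)
    also have "\<dots> = A ** Y"
      by (simp only: Y matrix_transpose_mul transpose_transpose)
    finally show ?thesis .
  qed
  have "A ** Y ** A = transpose (transpose A ** (A ** Y))"
    by (simp only: matrix_transpose_mul[of "transpose A" "A ** Y"] sym transpose_transpose)
  then have "A ** Y ** A = A"
    by (simp only: Y transpose_transpose)
  then show thesis
    using sym that by blast
qed

text \<open>\<open>Y\<close> makes \<open>A ** Y\<close> symmetric, and the same construction for
  the transpose yields a \<open>Z\<close> making \<open>Z ** A\<close> symmetric. Both are inner
  inverses, so \<open>Z ** A ** Y\<close> inherits its product with \<open>A\<close> on the left
  from \<open>Y\<close> and on the right from \<open>Z\<close>.\<close>

lemma moore_penrose_exists:
  fixes A :: "real^'n^'m"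
  shows "\<exists>X. is_moore_penrose A X"
proof -
  obtain Y where Y: "A ** Y ** A = A" "transpose (A ** Y) = A ** Y"
    using exists_least_squares_inverse .
  obtain Z' where Z': "transpose A ** Z' ** transpose A = transpose A"
      "transpose (transpose A ** Z') = transpose A ** Z'"
    using exists_least_squares_inverse .
  define Z where "Z = transpose Z'"
  have "A ** Z ** A = transpose (transpose A ** Z' ** transpose A)"
    by (simp only: matrix_transpose_mul transpose_transpose Z_def matrix_mul_assoc)
  then have Z: "A ** Z ** A = A"
    by (simp only: Z' transpose_transpose)
  have ZA: "transpose (Z ** A) = Z ** A"
    using Z'(2) by (simp add: matrix_transpose_mul Z_def)
  define X where "X = Z ** A ** Y"
  have AX: "A ** X = A ** Y"
    unfolding X_def by (simp only: matrix_mul_assoc Z)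
  have XA: "X ** A = Z ** A"
    unfolding X_def by (metis matrix_mul_assoc Y(1))
  have "X ** A ** X = X"
    unfolding XA unfolding X_def by (metis matrix_mul_assoc Z)
  then have "is_moore_penrose A X"
    unfolding is_moore_penrose_def AX XA using Y ZA by (simp add: XA)
  then show ?thesis ..
qed

text \<open>\<open>A ** X\<close> and \<open>A ** Y\<close> absorb each other and are symmetric, so
  transposing their product identifies them; likewise \<open>X ** A\<close> and
  \<open>Y ** A\<close>. Then \<open>X = X ** A ** X = Y ** A ** Y = Y\<close>.\<close>

lemma moore_penrose_unique:
  fixes A :: "real^'n^'m"
  assumes X: "is_moore_penrose A X" and Y: "is_moore_penrose A Y"
  shows "X = Y"
proof -
  have AX: "A ** X = A ** Y"
  proof -
    have "A ** X = transpose ((A ** Y) ** (A ** X))"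
      using X Y by (simp add: is_moore_penrose_def matrix_mul_assoc)
    also have "\<dots> = (A ** X) ** (A ** Y)"
      using X Y by (simp only: is_moore_penrose_def matrix_transpose_mul[of "A ** Y"])
    finally show ?thesis
      using X by (simp add: is_moore_penrose_def matrix_mul_assoc)
  qed
  have XA: "X ** A = Y ** A"
  proof -
    have "X ** A = transpose ((X ** A) ** (Y ** A))"
      using X Y by (metis is_moore_penrose_def matrix_mul_assoc)
    also have "\<dots> = (Y ** A) ** (X ** A)"
      using X Y by (simp only: is_moore_penrose_def matrix_transpose_mul[of "X ** A"])
    finally show ?thesis
      using X by (metis is_moore_penrose_def matrix_mul_assoc)
  qed
  show ?thesis
    using X Y AX XA by (metis is_moore_penrose_def matrix_mul_assoc)
qed

lemma is_moore_penrose_moore_penrose: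
  fixes A :: "real^'n^'m"
  shows "is_moore_penrose A (moore_penrose A)"
  unfolding moore_penrose_def
  using moore_penrose_exists moore_penrose_unique by (metis theI)

section \<open>Quadratic minimisation under linear constraints\<close>

text \<open>The equation for \<open>X\<close> makes \<open>X *v r\<close> a solution of
  \<open>L *v p = r\<close> as soon as \<open>r\<close> lies in the column space of
  \<open>L\<close>.\<close>

lemma is_arg_min_quadratic_linear_constraint:
  fixes A :: "real^'n^'m" and R :: "real^'n^'n"
  assumes sym: "transpose R = R"
    and pos: "\<And>x. x \<noteq> 0 \<Longrightarrow> x \<bullet> (R *v x) > 0"
    and L: "L = A ** matrix_inv R ** transpose A"
    and X: "L ** X ** L = L"
    and feasible: "b \<in> range ((*v) A)"
    and r: "r = A *v c\<^sub>0 - b"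
    and J: "J = (\<lambda>c. 1/2 * ((c - c\<^sub>0) \<bullet> (R *v (c - c\<^sub>0))))"
    and c': "c' = c\<^sub>0 - (matrix_inv R ** transpose A ** X) *v r"
  shows "is_arg_min J (\<lambda>c. A *v c = b) c \<longleftrightarrow> c = c'"
    and "J c' = 1/2 * (r \<bullet> (X *v r))"
proof -
  define W where "W = matrix_inv R"
  have "\<exists>B. B ** R = mat 1"
    unfolding matrix_left_invertible_ker using pos by (metis inner_zero_right less_irrefl)
  then have inv: "invertible R"
    by (meson invertible_def matrix_left_right_inverse)
  \<comment> \<open>\<open>matrix_inv\<close> is a choice operator, so its equations come from the
    existence of a two-sided inverse.\<close>
  then have "R ** W = mat 1 \<and> W ** R = mat 1"
    unfolding W_def invertible_def matrix_inv_def by (rule someI_ex)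
  then have RW: "R ** W = mat 1" and WR: "W ** R = mat 1"
    by auto
  have Wsym: "transpose W = W"
    by (metis RW WR matrix_mul_assoc matrix_mul_lid matrix_mul_rid matrix_transpose_mul sym
        transpose_mat)
  \<comment> \<open>Definiteness passes from \<open>R\<close> to its inverse: the form of
    \<open>W\<close> at \<open>y\<close> is the form of \<open>R\<close> at
    \<open>W *v y\<close>.\<close>
  have Wpos: "y = 0" if "y \<bullet> (W *v y) = 0" for y
  proof -
    have y: "R *v (W *v y) = y"
      by (simp add: matrix_vector_mul_assoc RW)
    then have "(W *v y) \<bullet> (R *v (W *v y)) = 0"
      using that by (simp add: inner_commute)
    then have "W *v y = 0"
      using pos by force
    then show ?thesis
      using y by simp
  qed
  have Lv: "L *v y = A *v (W *v (transpose A *v y))" for y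
    unfolding L W_def by (simp only: matrix_vector_mul_assoc matrix_mul_assoc)
  have Lsym: "transpose L = L"
    unfolding L using Wsym
    by (simp add: W_def matrix_transpose_mul matrix_mul_assoc)
  obtain c1 where c1: "A *v c1 = b"
    using feasible by auto
  \<comment> \<open>The least-squares residual \<open>z\<close> satisfies \<open>L *v z = 0\<close>.
    Pairing with \<open>z\<close> gives the form of \<open>W\<close> at
    \<open>transpose A *v z\<close>, so that vector is zero. But \<open>z\<close> also lies in the
    column space of \<open>A\<close>, hence is orthogonal to itself.\<close>
  have "\<exists>y. L *v y = r"
  proof -
    obtain y where "transpose L *v (r - L *v y) = 0"
      using normal_equations_solvable .
    then have Lz: "L *v (r - L *v y) = 0"
      by (simp only: Lsym)
    define z where "z = r - L *v y"
    have "(transpose A *v z) \<bullet> (W *v (transpose A *v z)) = 0"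
      using Lz unfolding Lv[of "r - L *v y"]
      by (simp only: inner_matrix_vector_mult[symmetric] z_def inner_zero_right)
    then have Az: "transpose A *v z = 0"
      using Wpos by blast
    have z: "z = A *v (c\<^sub>0 - c1 - W *v (transpose A *v y))"
      unfolding z_def r c1[symmetric] Lv by (simp only: matrix_vector_mult_diff_distrib)
    have "z \<bullet> z = 0"
      by (subst (2) z) (simp only: inner_matrix_vector_mult Az inner_zero_left)
    then show ?thesis
      by (auto simp: z_def)
  qed
  then have Lr: "L *v (X *v r) = r"
    using X by (metis matrix_vector_mul_assoc)
  \<comment> \<open>\<open>p\<close> is the Lagrange multiplier (node potentials in the network),
    and \<open>d\<close> is the displacement from \<open>c\<^sub>0\<close> with stationarity
    condition \<open>R *v d = transpose A *v p\<close>.\<close>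
  define p where "p = X *v r"
  define d where "d = W *v (transpose A *v p)"
  have c'd: "c' = c\<^sub>0 - d"
    unfolding c' d_def p_def W_def by (simp only: matrix_vector_mul_assoc matrix_mul_assoc)
  have Ad: "A *v d = r"
    using Lr unfolding Lv d_def p_def .
  have Rd: "R *v d = transpose A *v p"
    unfolding d_def by (simp only: matrix_vector_mul_assoc RW matrix_mul_assoc matrix_mul_lid)
  have Ac': "A *v c' = b"
    unfolding c'd matrix_vector_mult_diff_distrib Ad r by simp
  have dRd: "d \<bullet> (R *v d) = r \<bullet> p"
    unfolding Rd by (metis Ad inner_commute inner_matrix_vector_mult)
  then show "J c' = 1/2 * (r \<bullet> (X *v r))"
    unfolding J c'd p_def
    by (simp add: vec.neg)
  \<comment> \<open>The cross terms vanish because \<open>c - c'\<close> lies in the kernel of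
    \<open>A\<close>, while \<open>R *v d\<close> lies in the range of
    \<open>transpose A\<close>.\<close>
  have *: "J c = J c' + 1/2 * ((c - c') \<bullet> (R *v (c - c')))" if "A *v c = b" for c
  proof -
    define h where "h = c - c'"
    have "A *v h = 0"
      unfolding h_def matrix_vector_mult_diff_distrib that Ac' by simp
    then have hRd: "h \<bullet> (R *v d) = 0"
      unfolding Rd by (metis inner_commute inner_matrix_vector_mult inner_zero_right)
    have dRh: "d \<bullet> (R *v h) = 0"
      unfolding inner_matrix_vector_mult sym by (metis hRd inner_commute)
    have c: "c - c\<^sub>0 = h - d" "c' - c\<^sub>0 = - d"
      by (auto simp: h_def c'd)
    show ?thesis
      unfolding J c h_def[symmetric]
      by (simp add: matrix_vector_mult_diff_distrib inner_diff hRd dRh vec.neg field_simps)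
  qed
  show "is_arg_min J (\<lambda>c. A *v c = b) c \<longleftrightarrow> c = c'"
  proof
    assume min: "is_arg_min J (\<lambda>c. A *v c = b) c"
    show "c = c'"
    proof (rule ccontr)
      assume "c \<noteq> c'"
      then have "J c' < J c"
        using * pos[of "c - c'"] min by (simp add: is_arg_min_def)
      then show False
        using min Ac' by (auto simp: is_arg_min_def)
    qed
  next
    have "J c' \<le> J c" if "A *v c = b" for c
      using *[OF that] pos[of "c - c'"] by (cases "c = c'") auto
    moreover assume "c = c'"
    ultimately show "is_arg_min J (\<lambda>c. A *v c = b) c"
      using Ac' by (force simp: is_arg_min_def)
  qed
qed

section \<open>Positive diagonal matrices\<close>

lemma transpose_diag_matrix: "transpose (diag_matrix d) = diag_matrix d"
  by (simp add: diag_matrix_def transpose_def vec_eq_iff)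

lemma diag_matrix_mult_vector: "(diag_matrix d *v x) $ i = d i * x $ i"
  by (simp add: diag_matrix_def matrix_vector_mult_def if_distrib[of "\<lambda>z. z * _"] cong: if_cong)

lemma diag_matrix_pos_def:
  assumes "\<And>i. d i > 0" and "x \<noteq> 0"
  shows "x \<bullet> (diag_matrix d *v x) > 0"
proof -
  obtain i where "x $ i \<noteq> 0"
    using assms(2) by (auto simp: vec_eq_iff)
  then have "(\<Sum>i\<in>UNIV. d i * (x $ i)\<^sup>2) > 0"
    using assms(1) by (intro sum_pos2[of _ i]) (auto simp: less_imp_le)
  then show ?thesis
    by (simp add: inner_vec_def diag_matrix_mult_vector power2_eq_square mult_ac)
qed

section \<open>Feasibility of flow conservation\<close>

lemma incidence_matrix_mult_axis:
  "incidence_matrix vm vp *v axis e 1 = axis (vp e) 1 - axis (vm e) 1"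
  unfolding matrix_vector_mult_basis
  by (auto simp: incidence_matrix_def head_matrix_def tail_matrix_def column_def vec_eq_iff axis_def)

lemma edge_in_range_incidence_matrix:
  "axis (vp e) 1 - axis (vm e) 1 \<in> range ((*v) (incidence_matrix vm vp))"
  by (metis incidence_matrix_mult_axis rangeI)

text \<open>Each traversed edge contributes its column of the incidence matrix, with sign given by
  the direction, and the unit vectors telescope.\<close>

lemma walk_in_range_incidence_matrix:
  assumes "walk vm vp a es b"
  shows "axis b 1 - axis a 1 \<in> range ((*v) (incidence_matrix vm vp))"
  using assms
proof (induction es arbitrary: a)
  case Nil
  then show ?case
    by (simp add: subspace_0 subspace_range_matrix)
next
  case (Cons e es)
  note S = subspace_range_matrix[of "incidence_matrix vm vp"]
  note E = edge_in_range_incidence_matrix[of vp e vm]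
  from Cons.prems consider "vm e = a" "walk vm vp (vp e) es b" | "vp e = a" "walk vm vp (vm e) es b"
    by auto
  then show ?case
  proof cases
    case 1
    then show ?thesis
      using subspace_add[OF S Cons.IH[OF 1(2)] E] by simp
  next
    case 2
    then show ?thesis
      using subspace_diff[OF S Cons.IH[OF 2(2)] E] by simp
  qed
qed

text \<open>A location is represented by the head of its edge, where \<open>head_matrix\<close>
  counts it. Leaving by the head costs nothing, leaving by the tail costs one column.\<close>

lemma end_distance_in_range_incidence_matrix:
  assumes "end_distance l vm vp p a d"
  shows "axis (vp (fst p)) 1 - axis a 1 \<in> range ((*v) (incidence_matrix vm vp))"
  using assms
  by cases (auto simp: edge_in_range_incidence_matrix subspace_0[OF subspace_range_matrix])

lemma route_in_range_incidence_matrix: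
  assumes "route l vm vp p q d"
  shows "axis (vp (fst p)) 1 - axis (vp (fst q)) 1 \<in> range ((*v) (incidence_matrix vm vp))"
  using assms
proof cases
  case within_edge
  then show ?thesis
    by (simp add: subspace_0 subspace_range_matrix)
next
  case (via_nodes a d1 es b d2)
  note S = subspace_range_matrix[of "incidence_matrix vm vp"]
  \<comment> \<open>With \<open>p\<close>, \<open>q\<close> standing for the heads of their edges:
    \<open>(p - a) - (q - b) - (b - a) = p - q\<close>.\<close>
  show ?thesis
    using subspace_diff[OF S
        subspace_diff[OF S end_distance_in_range_incidence_matrix[OF via_nodes(2)]
          end_distance_in_range_incidence_matrix[OF via_nodes(4)]]
        walk_in_range_incidence_matrix[OF via_nodes(3)]]
    by simp
qed

lemma card_Int_edge_upto_length:
  assumes "U \<subseteq> locations l"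
  shows "card (U \<inter> edge_upto e (l e)) = card {u \<in> U. fst u = e}"
proof -
  have "U \<inter> edge_upto e (l e) = {u \<in> U. fst u = e}"
    using assms by (auto simp: locations_def edge_upto_def)
  then show ?thesis
    by simp
qed

text \<open>Double counting: the points are grouped by the edge that carries them.\<close>

lemma head_matrix_mult_counts:
  assumes "finite U"
  shows "head_matrix vp *v (\<chi> e. real (card {u \<in> U. fst u = e})) = (\<Sum>u\<in>U. axis (vp (fst u)) 1)"
proof (subst vec_eq_iff, rule allI)
  fix v
  have "(head_matrix vp *v (\<chi> e. real (card {u \<in> U. fst u = e}))) $ v
      = (\<Sum>e\<in>UNIV. \<Sum>u\<in>{u \<in> U. fst u = e}. if vp (fst u) = v then 1 else 0)"
    by (auto simp: head_matrix_def matrix_vector_mult_def intro!: sum.cong)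
  also have "\<dots> = (\<Sum>u\<in>U. if vp (fst u) = v then 1 else 0)"
    using assms by (intro sum.group) auto
  also have "\<dots> = (\<Sum>u\<in>U. axis (vp (fst u)) 1) $ v"
    by (auto simp: axis_def intro!: sum.cong)
  finally show "(head_matrix vp *v (\<chi> e. real (card {u \<in> U. fst u = e}))) $ v
      = (\<Sum>u\<in>U. axis (vp (fst u)) 1) $ v" .
qed

lemma flow_conservation_feasible:
  assumes "finite U" "U \<subseteq> locations l" "finite V" "V \<subseteq> locations l" "bij_betw m U V"
    and route: "\<And>u. u \<in> U \<Longrightarrow> \<exists>d. route l vm vp u (m u) d"
  shows "head_matrix vp *v (\<chi> e. imbalance U V e (l e)) \<in> range ((*v) (incidence_matrix vm vp))"
proof -
  have "(\<chi> e. imbalance U V e (l e))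
      = (\<chi> e. real (card {u \<in> U. fst u = e})) - (\<chi> e. real (card {v \<in> V. fst v = e}))"
    using assms by (simp add: imbalance_def card_Int_edge_upto_length vec_eq_iff)
  then have "head_matrix vp *v (\<chi> e. imbalance U V e (l e))
      = (\<Sum>u\<in>U. axis (vp (fst u)) 1) - (\<Sum>v\<in>V. axis (vp (fst v)) 1)"
    using assms by (simp add: matrix_vector_mult_diff_distrib head_matrix_mult_counts)
  \<comment> \<open>Reindexing the demand sum along the bijection \<open>m\<close> pairs each supply
    point with its partner, so the route between them handles each summand.\<close>
  also have "\<dots> = (\<Sum>u\<in>U. axis (vp (fst u)) 1 - axis (vp (fst (m u))) 1)"
    unfolding sum_subtractf sum.reindex_bij_betw[OF assms(5), symmetric] ..
  also have "\<dots> \<in> range ((*v) (incidence_matrix vm vp))"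
    using route by (intro subspace_sum subspace_range_matrix) (metis route_in_range_incidence_matrix)
  finally show ?thesis .
qed

theorem mainTheorem8:
  fixes l :: "'e::finite \<Rightarrow> real"
    and vm vp :: "'e \<Rightarrow> 'v::finite"
    and U V :: "'e location set"
    and n :: nat
    and m :: "'e location \<Rightarrow> 'e location"
    and Q Q' :: "real \<Rightarrow> 'e \<Rightarrow> real \<Rightarrow> real"
    and \<epsilon> :: real
  assumes len: "\<And>e. l e \<ge> 0"
    and sources: "finite U" "U \<subseteq> locations l" "card U = n"
    and sinks: "finite V" "V \<subseteq> locations l" "card V = n"
    and matching: "bij_betw m U V" "\<And>u. u \<in> U \<Longrightarrow> \<exists>d. shortest_route l vm vp u (m u) d"
    and smooth: "\<And>\<delta> e. \<delta> > 0 \<Longrightarrow> C2_with_deriv 0 (l e) (Q \<delta> e) (Q' \<delta> e)"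
    and increasing: "\<And>\<delta> e x. \<delta> > 0 \<Longrightarrow> x \<in> {0..l e} \<Longrightarrow> Q' \<delta> e x > 0"
    and approx: "((\<lambda>\<delta>. Max (range (\<lambda>e.
          L1_dist (l e) (Q \<delta> e) (profile_quantile (l e) (imbalance U V e))))) \<longlongrightarrow> 0) (at_right 0)"
    and eps: "\<epsilon> > 0"
  shows
    "let I = incidence_matrix vm vp;
         s = (\<chi> e. imbalance U V e (l e));
         b = head_matrix vp *v s;
         c\<^sub>0 = (\<chi> e. Q \<epsilon> e (l e / 2));
         R = diag_matrix (\<lambda>e. 1 / Q' \<epsilon> e (l e / 2));
         L = I ** matrix_inv R ** transpose I;
         r = I *v c\<^sub>0 - b;
         J = (\<lambda>c. 1/2 * ((c - c\<^sub>0) \<bullet> (R *v (c - c\<^sub>0))));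
         c' = c\<^sub>0 - (matrix_inv R ** transpose I ** moore_penrose L) *v r
     in (\<forall>c. is_arg_min J (\<lambda>c. I *v c = b) c \<longleftrightarrow> c = c') \<and>
        J c' = 1/2 * (r \<bullet> (moore_penrose L *v r))"
proof -
  let ?I = "incidence_matrix vm vp"
  let ?b = "head_matrix vp *v (\<chi> e. imbalance U V e (l e))"
  let ?R = "diag_matrix (\<lambda>e. 1 / Q' \<epsilon> e (l e / 2))"
  have feasible: "?b \<in> range ((*v) ?I)"
    using sources sinks matching unfolding shortest_route_def
    by (intro flow_conservation_feasible[where m = m]) blast+
  \<comment> \<open>Nonnegative length puts the midpoint in \<open>{0..l e}\<close>, where the
    derivative is positive; this also covers edges of length zero.\<close>
  have "0 < 1 / Q' \<epsilon> e (l e / 2)" for e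
    using increasing[OF eps] len[of e] by simp
  then have pos: "x \<bullet> (?R *v x) > 0" if "x \<noteq> 0" for x
    using that by (intro diag_matrix_pos_def)
  have mp: "L ** moore_penrose L ** L = L" for L :: "real^'v^'v"
    using is_moore_penrose_moore_penrose[of L] by (simp add: is_moore_penrose_def)
  show ?thesis
    unfolding Let_def
    by (intro conjI allI
        is_arg_min_quadratic_linear_constraint[OF transpose_diag_matrix pos refl mp feasible refl refl refl])
qed

end
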